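(* Let $s(n,k)$ be the number of partial packing paths of width $n$ ending at height $k$ (with $s(n,k)=0$ for $n<0$). The matrices $\mathcal S_e=[s(4n-2k,2k)]_{n,k\ge0}$ and $\mathcal S_o=[s(2n+1,2k+1)]_{n,k\ge0}$ are Riordan arrays. More precisely, $$\mathcal S_e=\left(\frac{1-x-\sqrt{1-10x+9x^2}}{4x},\ \frac{1-3x-\sqrt{1-10x+9x^2}}{2}\right)$$ and $$\mathcal S_o=\left(\frac{1+2x-5x^2-6x^3-(1+2x)\sqrt{1-10x^2+9x^4}}{4x^3},\ \frac{1-3x^2-\sqrt{1-10x^2+9x^4}}{2x}\right).$$
   Context: A Riordan array $(g(x),f(x))$, for formal power series with $g(0)\ne0$, $f(0)=0$, $f'(0)\neq0$, is the infinite lower triangular matrix whose $k$-th column ($k\ge0$) has generating function $g(x)f(x)^k$, i.e. its $(n,k)$ entry is $[x^n]g(x)f(x)^k$. Consider the hexagonal packing of the plane by circles of radius $2$ with centers $(2+4i+2j,\,2\sqrt3\,j)$, $i,j\in\mathbb Z$; the origin is the tangency point of two horizontally adjacent circles. The tangency points cut every circle into six arcs. Traversed from left to right these give six types of steps (angles measured on the circle carrying the arc): $U$ from $180^\circ$ to $120^\circ$ (displacement $(1,\sqrt3)$), $F$ from $120^\circ$ to $60^\circ$ (displacement $(2,0)$), $D$ from $60^\circ$ to $0^\circ$ (displacement $(1,-\sqrt3)$), $\overline U$ from $300^\circ$ to $360^\circ$ (displacement $(1,\sqrt3)$), $\overline F$ from $240^\circ$ to $300^\circ$ (displacement $(2,0)$),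 $\overline D$ from $180^\circ$ to $240^\circ$ (displacement $(1,-\sqrt3)$). A path in the packing starts at the origin, is a concatenation of such arcs of circles of the packing, each starting where the previous one ends, and stays in the quarter plane $x,y\ge 0$. Equivalently, it is a word in $\{U,F,D,\overline U,\overline F,\overline D\}$ whose first step (if any) is $U$, in which $U$ or $\overline F$ can only be followed by $F$ or $\overline U$; $F$ or $\overline D$ only by $\overline F$ or $D$; $\overline U$ or $D$ only by $U$ or $\overline D$; and which never goes below ordinate $0$. A packing path is such a path ending on the $x$-axis; a partial packing path is any prefix of a packing path. The empty path is allowed. The width of a path is the abscissa of its endpoint (so $U,D,\overline U,\overline D$ contribute $1$ and $F,\overline F$ contribute $2$). The (final) height of a path is the integer $k$ such that its endpoint has ordinate $k\sqrt3$. *)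

theory Defs
  imports
    "HOL-Complex_Analysis.Contour_Integration"
    "HOL-Computational_Algebra.Formal_Power_Series"
    "HOL-Library.Sublist"
begin

text \<open>The bars in the usual notation for the steps become the suffix \<open>bar\<close>. Angles are
  in radians, and are measured on the circle that carries the arc.\<close>

datatype step = U | F | D | Ubar | Fbar | Dbar

fun start_angle :: "step \<Rightarrow> real" where
  "start_angle U = pi"
| "start_angle F = 2 * pi / 3"
| "start_angle D = pi / 3"
| "start_angle Ubar = 5 * pi / 3"
| "start_angle Fbar = 4 * pi / 3"
| "start_angle Dbar = pi"

fun end_angle :: "step \<Rightarrow> real" where
  "end_angle U = 2 * pi / 3"
| "end_angle F = pi / 3"
| "end_angle D = 0"
| "end_angle Ubar = 2 * pi"
| "end_angle Fbar = 5 * pi / 3"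
| "end_angle Dbar = 4 * pi / 3"

definition circle_center :: "int \<Rightarrow> int \<Rightarrow> complex" where
  "circle_center i j = Complex (2 + 4 * of_int i + 2 * of_int j) (2 * sqrt 3 * of_int j)"

text \<open>The arc \<open>(i, j, st)\<close> is the arc of type \<open>st\<close> on the circle with centre
  \<open>circle_center i j\<close>. Different triples give different arcs, so lists of triples
  represent concatenations of arcs uniquely.\<close>

type_synonym arc = "int \<times> int \<times> step"

fun arc_curve :: "arc \<Rightarrow> real \<Rightarrow> complex" where
  "arc_curve (i, j, st) = part_circlepath (circle_center i j) 2 (start_angle st) (end_angle st)"

definition quarter_plane :: "complex set" where
  "quarter_plane = {z. 0 \<le> Re z \<and> 0 \<le> Im z}"

definition quarter_plane_path :: "arc list \<Rightarrow> bool" where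
  "quarter_plane_path p \<longleftrightarrow>
     (p \<noteq> [] \<longrightarrow> pathstart (arc_curve (hd p)) = 0) \<and>
     successively (\<lambda>a b. pathfinish (arc_curve a) = pathstart (arc_curve b)) p \<and>
     (\<forall>a\<in>set p. path_image (arc_curve a) \<subseteq> quarter_plane)"

definition endpoint :: "arc list \<Rightarrow> complex" where
  "endpoint p = (if p = [] then 0 else pathfinish (arc_curve (last p)))"

definition packing_path :: "arc list \<Rightarrow> bool" where
  "packing_path p \<longleftrightarrow> quarter_plane_path p \<and> Im (endpoint p) = 0"

definition partial_packing_path :: "arc list \<Rightarrow> bool" where
  "partial_packing_path p \<longleftrightarrow> (\<exists>q. packing_path q \<and> prefix p q)"

text \<open>The width is an integer argument, so that it may be negative; the set below is then empty,
  since endpoints lie in the quarter plane. The set is always finite, because every arc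
  increases the abscissa by at least \<open>1\<close>.\<close>

definition num_partial :: "int \<Rightarrow> nat \<Rightarrow> nat" where
  "num_partial n k =
     card {p. partial_packing_path p \<and> Re (endpoint p) = of_int n
            \<and> Im (endpoint p) = of_nat k * sqrt 3}"

definition even_matrix :: "nat \<Rightarrow> nat \<Rightarrow> nat" where
  "even_matrix n k = num_partial (4 * int n - 2 * int k) (2 * k)"

definition odd_matrix :: "nat \<Rightarrow> nat \<Rightarrow> nat" where
  "odd_matrix n k = num_partial (2 * int n + 1) (2 * k + 1)"

text \<open>An infinite matrix \<open>M\<close>, with entries \<open>M n k\<close> in row \<open>n\<close> and column \<open>k\<close>, is the
  Riordan array \<open>(g, f)\<close>.\<close>

definition is_riordan_array ::
    "(nat \<Rightarrow> nat \<Rightarrow> 'a) \<Rightarrow> 'a::comm_ring_1 fps \<Rightarrow> 'a fps \<Rightarrow> bool" where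
  "is_riordan_array M g f \<longleftrightarrow>
     fps_nth g 0 \<noteq> 0 \<and> fps_nth f 0 = 0 \<and> fps_nth (fps_deriv f) 0 \<noteq> 0 \<and>
     (\<forall>n k. M n k = fps_nth (g * f ^ k) n)"

text \<open>For a series with constant term \<open>1\<close>, this is the square root with constant term \<open>1\<close>.
  Quotients such as \<open>a / (4 * fps_X)\<close> are Laurent quotients with any negative powers
  discarded, so they are exact when the numerator has sufficient subdegree.\<close>

abbreviation fps_sqrt :: "real fps \<Rightarrow> real fps" where
  "fps_sqrt a \<equiv> fps_radical root 2 a"

end

theory Submission
  imports Defs "HOL-Computational_Algebra.Formal_Laurent_Series"
begin

text \<open>The position \<open>(X, H)\<close> of the endpoint determines the possible continuations: there are
  three classes of tangency points, each with two incoming and two outgoing arcs. Every path in the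
  quarter plane extends to a packing path, so \<open>num_partial\<close> counts all paths with a given endpoint,
  and removing the last arc gives linear recurrences. Their solution is a Motzkin path count: for
  the power series \<open>f\<close> with \<open>f\<^sup>2 - (1 - 3 x) f + x = 0\<close> and \<open>h = 1 / (1 - 2 x - f)\<close>, the paths that
  end in column \<open>k\<close> of the three classes have generating functions \<open>(1 - x) h f\<^sup>k\<close>,
  \<open>h (1 + f) f\<^sup>k\<close> and \<open>h (f + x) f\<^sup>k\<close>.\<close>

subsection \<open>Recurrences for the number of paths with a given endpoint\<close>

text \<open>In units of 1 horizontally and \<open>sqrt 3\<close> vertically, the circle is centred
  at \<open>(4 * i + 2 * j + 2, 2 * j)\<close>; its six tangency points are offset by
  \<open>(2, 0)\<close>, \<open>(1, 1)\<close>, \<open>(1, -1)\<close> and their negatives.\<close>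

fun arc_source :: "arc \<Rightarrow> int \<times> int" where
  "arc_source (i, j, U) = (4 * i + 2 * j, 2 * j)"
| "arc_source (i, j, F) = (4 * i + 2 * j + 1, 2 * j + 1)"
| "arc_source (i, j, D) = (4 * i + 2 * j + 3, 2 * j + 1)"
| "arc_source (i, j, Ubar) = (4 * i + 2 * j + 3, 2 * j - 1)"
| "arc_source (i, j, Fbar) = (4 * i + 2 * j + 1, 2 * j - 1)"
| "arc_source (i, j, Dbar) = (4 * i + 2 * j, 2 * j)"

fun arc_target :: "arc \<Rightarrow> int \<times> int" where
  "arc_target (i, j, U) = (4 * i + 2 * j + 1, 2 * j + 1)"
| "arc_target (i, j, F) = (4 * i + 2 * j + 3, 2 * j + 1)"
| "arc_target (i, j, D) = (4 * i + 2 * j + 4, 2 * j)"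
| "arc_target (i, j, Ubar) = (4 * i + 2 * j + 4, 2 * j)"
| "arc_target (i, j, Fbar) = (4 * i + 2 * j + 3, 2 * j - 1)"
| "arc_target (i, j, Dbar) = (4 * i + 2 * j + 1, 2 * j - 1)"

text \<open>Endpoints of arcs are represented by integer pairs \<open>(X, H)\<close>: width and height.\<close>

definition lattice_point :: "int \<times> int \<Rightarrow> complex" where
  "lattice_point v = Complex (of_int (fst v)) (of_int (snd v) * sqrt 3)"

lemma lattice_point_eq_iff [simp]: "lattice_point v = lattice_point w \<longleftrightarrow> v = w"
  by (auto simp: lattice_point_def prod_eq_iff)

lemma lattice_point_origin: "lattice_point (0, 0) = 0"
  by (simp add: lattice_point_def complex_eq_iff)

lemma lattice_point_in_quarter_plane [simp]:
  "lattice_point v \<in> quarter_plane \<longleftrightarrow> 0 \<le> fst v \<and> 0 \<le> snd v"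
  by (auto simp: lattice_point_def quarter_plane_def zero_le_mult_iff)

lemma part_circlepath_eq_Complex:
  "part_circlepath z r s t u =
     Complex (Re z + r * cos (linepath s t u)) (Im z + r * sin (linepath s t u))"
  by (simp add: part_circlepath_def complex_eq_iff Re_exp Im_exp linepath_of_real flip: of_real_mult)

lemma cos_sin_multiples_pi_third:
  "cos (2 * pi / 3) = - (1 / 2)" "sin (2 * pi / 3) = sqrt 3 / 2"
  "cos (4 * pi / 3) = - (1 / 2)" "sin (4 * pi / 3) = - (sqrt 3 / 2)"
  "cos (5 * pi / 3) = 1 / 2" "sin (5 * pi / 3) = - (sqrt 3 / 2)"
proof -
  have *: "2 * pi / 3 = pi - pi / 3" "4 * pi / 3 = pi / 3 + pi" "5 * pi / 3 = - (pi / 3) + 2 * pi"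
    by auto
  show "cos (2 * pi / 3) = - (1 / 2)" "sin (2 * pi / 3) = sqrt 3 / 2"
    unfolding *(1) sin_pi_minus cos_pi_minus by (simp_all only: cos_60 sin_60)
  show "cos (4 * pi / 3) = - (1 / 2)" "sin (4 * pi / 3) = - (sqrt 3 / 2)"
    unfolding *(2) sin_periodic_pi cos_periodic_pi by (simp_all only: cos_60 sin_60)
  show "cos (5 * pi / 3) = 1 / 2" "sin (5 * pi / 3) = - (sqrt 3 / 2)"
    unfolding *(3) cos_periodic sin_periodic by (simp_all add: cos_60 sin_60)
qed

lemma pathstart_arc_curve: "pathstart (arc_curve a) = lattice_point (arc_source a)"
  by (cases a rule: arc_source.cases;
      auto simp: pathstart_def part_circlepath_eq_Complex linepath_def circle_center_def
       lattice_point_def cos_sin_multiples_pi_third cos_60 sin_60;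
      simp add: algebra_simps)

lemma pathfinish_arc_curve: "pathfinish (arc_curve a) = lattice_point (arc_target a)"
  by (cases a rule: arc_source.cases;
      auto simp: pathfinish_def part_circlepath_eq_Complex linepath_def circle_center_def
       lattice_point_def cos_sin_multiples_pi_third cos_60 sin_60;
      simp add: algebra_simps)

text \<open>For each coordinate separately, integrality puts either the whole circle or the half
  that carries the arc on the nonnegative side.\<close>

lemma path_image_arc_curve_subset_quarter_plane:
  assumes "arc_source a = (X, H)" "0 \<le> X" "0 \<le> H" "0 \<le> snd (arc_target a)"
  shows "path_image (arc_curve a) \<subseteq> quarter_plane"
proof
  fix z assume "z \<in> path_image (arc_curve a)"
  obtain i j st where a: "a = (i, j, st)" by (cases a)
  from \<open>z \<in> _\<close> obtain u where u: "0 \<le> u" "u \<le> 1" and z: "z = arc_curve a u"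
    by (auto simp: path_image_def)
  define t where "t = linepath (start_angle st) (end_angle st) u"
  have t: "t \<in> closed_segment (start_angle st) (end_angle st)"
    using u unfolding t_def by (simp add: linepath_in_path)
  have Re: "Re z = 2 + 4 * of_int i + 2 * of_int j + 2 * cos t"
    and Im: "Im z = 2 * sqrt 3 * of_int j + 2 * sin t"
    using z by (simp_all add: a part_circlepath_eq_Complex circle_center_def t_def)
  have "0 \<le> Re z"
  proof (cases "st \<in> {D, Ubar}")
    case False
    then have "0 \<le> 2 * i + j" using assms a by (cases st) auto
    then have "(0::real) \<le> 2 * of_int i + of_int j" by linarith
    then show ?thesis using cos_ge_minus_one[of t] Re by linarith
  next
    case True
    have "0 \<le> 1 + 2 * i + j" using True assms a by auto
    then have "(0::real) \<le> 1 + 2 * of_int i + of_int j" by linarith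
    moreover have "0 \<le> cos t"
    proof (cases "st = D")
      case True
      then have "0 \<le> t" "t \<le> pi / 3"
        using t by (auto simp: closed_segment_eq_real_ivl split: if_splits)
      then show ?thesis using pi_gt_zero by (intro cos_ge_zero) linarith+
    next
      case False
      with True have "5 * pi / 3 \<le> t" "t \<le> 2 * pi"
        using t by (auto simp: closed_segment_eq_real_ivl split: if_splits)
      then have "0 \<le> cos (t - 2 * pi)" using pi_gt_zero by (intro cos_ge_zero) linarith+
      then show ?thesis by (simp add: cos_diff)
    qed
    ultimately show ?thesis using Re by linarith
  qed
  moreover have "0 \<le> Im z"
  proof (cases "st \<in> {U, F, D}")
    case True
    then have j: "0 \<le> j" using assms a by auto
    have "0 \<le> t" "t \<le> pi"
      using t True by (auto simp: closed_segment_eq_real_ivl split: if_splits; use pi_gt_zero in linarith)+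
    then have "0 \<le> sin t" by (rule sin_ge_zero)
    with j show ?thesis by (simp add: Im)
  next
    case False
    \<comment> \<open>A lower arc has an end at height \<open>2 * j - 1\<close>, which for
      \<open>Dbar\<close> is the target. So the centre has ordinate at least
      \<open>2 * sqrt 3\<close>, more than the radius.\<close>
    then have "1 \<le> j" using assms a by (cases st) auto
    then have "1 * 1 \<le> sqrt 3 * real_of_int j" by (intro mult_mono) auto
    then show ?thesis using sin_ge_minus_one[of t] unfolding Im mult.assoc by linarith
  qed
  ultimately show "z \<in> quarter_plane" by (simp add: quarter_plane_def)
qed

section \<open>Paths sorted by endpoint\<close>

lemma quarter_plane_path_Nil [simp]: "quarter_plane_path []"
  by (simp add: quarter_plane_path_def)

lemma endpoint_Nil [simp]: "endpoint [] = lattice_point (0, 0)"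
  by (simp add: endpoint_def lattice_point_origin)

lemma endpoint_snoc [simp]: "endpoint (p @ [a]) = lattice_point (arc_target a)"
  by (simp add: endpoint_def pathfinish_arc_curve)

lemma quarter_plane_path_snoc:
  "quarter_plane_path (p @ [a]) \<longleftrightarrow>
     quarter_plane_path p \<and> endpoint p = lattice_point (arc_source a) \<and>
     path_image (arc_curve a) \<subseteq> quarter_plane"
  by (cases p rule: rev_cases)
     (auto simp: quarter_plane_path_def successively_append_iff pathstart_arc_curve
       endpoint_def lattice_point_origin hd_append)

definition paths_to :: "int \<times> int \<Rightarrow> arc list set" where
  "paths_to v = {p. quarter_plane_path p \<and> endpoint p = lattice_point v}"

lemma endpoint_in_quarter_plane: "quarter_plane_path p \<Longrightarrow> endpoint p \<in> quarter_plane"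
proof (cases p rule: rev_cases)
  case (snoc q a)
  assume "quarter_plane_path p"
  with snoc have "path_image (arc_curve a) \<subseteq> quarter_plane" by (simp add: quarter_plane_path_snoc)
  with pathfinish_in_path_image[of "arc_curve a"] snoc show ?thesis
    by (auto simp flip: pathfinish_arc_curve)
qed simp

lemma paths_to_eq_empty: "fst v < 0 \<or> snd v < 0 \<Longrightarrow> paths_to v = {}"
  using endpoint_in_quarter_plane by (fastforce simp: paths_to_def)

text \<open>The geometry shrinks to one inequality: a nonempty
  \<open>paths_to (arc_source a)\<close> already puts the source in the quarter plane.\<close>

lemma snoc_in_paths_to_iff:
  "p @ [a] \<in> paths_to v \<longleftrightarrow> p \<in> paths_to (arc_source a) \<and> arc_target a = v \<and> 0 \<le> snd v"
proof
  assume *: "p @ [a] \<in> paths_to v"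
  then have "0 \<le> snd v" using paths_to_eq_empty[of v] by fastforce
  with * show "p \<in> paths_to (arc_source a) \<and> arc_target a = v \<and> 0 \<le> snd v"
    by (auto simp: paths_to_def quarter_plane_path_snoc)
next
  assume *: "p \<in> paths_to (arc_source a) \<and> arc_target a = v \<and> 0 \<le> snd v"
  then have "0 \<le> fst (arc_source a)" "0 \<le> snd (arc_source a)"
    using paths_to_eq_empty[of "arc_source a"] by fastforce+
  with * show "p @ [a] \<in> paths_to v"
    using path_image_arc_curve_subset_quarter_plane[of a "fst (arc_source a)" "snd (arc_source a)"]
    by (simp add: paths_to_def quarter_plane_path_snoc)
qed

lemma paths_to_unfold:
  assumes "0 \<le> snd v"
  shows "paths_to v = (if v = (0, 0) then {[]} else {}) \<union>
           (\<Union>a\<in>arc_target -` {v}. (\<lambda>p. p @ [a]) ` paths_to (arc_source a))"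
    (is "?L = ?R")
proof (intro set_eqI)
  fix p
  show "p \<in> ?L \<longleftrightarrow> p \<in> ?R"
  proof (cases p rule: rev_cases)
    case Nil
    then show ?thesis by (auto simp: paths_to_def)
  next
    case (snoc q a)
    then show ?thesis using assms by (auto simp: snoc_in_paths_to_iff)
  qed
qed

text \<open>Target and step type together determine the circle.\<close>

lemma finite_arc_target_vimage: "finite (arc_target -` {v})"
proof (rule inj_on_finite[where f = "\<lambda>a. snd (snd a)" and B = "{U, F, D, Ubar, Fbar, Dbar}"])
  show "inj_on (\<lambda>a. snd (snd a)) (arc_target -` {v})"
  proof (rule inj_onI)
    fix a b
    assume "a \<in> arc_target -` {v}" "b \<in> arc_target -` {v}" "snd (snd a) = snd (snd b)"
    then show "a = b" by (cases a rule: arc_source.cases; cases b) auto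
  qed
  show "(\<lambda>a. snd (snd a)) ` (arc_target -` {v}) \<subseteq> {U, F, D, Ubar, Fbar, Dbar}"
    using step.exhaust by auto
qed simp

lemma fst_arc_source_less: "fst (arc_source a) < fst (arc_target a)"
  by (cases a rule: arc_source.cases) auto

lemma finite_paths_to: "finite (paths_to v)"
proof (induction "nat (fst v + 1)" arbitrary: v rule: less_induct)
  case less
  show ?case
  proof (cases "fst v < 0 \<or> snd v < 0")
    case False
    have "finite (paths_to (arc_source a))" if "arc_target a = v" for a
      using that False fst_arc_source_less[of a] by (intro less) auto
    with False show ?thesis
      using finite_arc_target_vimage by (subst paths_to_unfold) auto
  qed (simp add: paths_to_eq_empty)
qed

lemma card_paths_to:
  assumes "0 \<le> snd v"
  shows "card (paths_to v) = of_bool (v = (0, 0)) +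
           (\<Sum>a\<in>arc_target -` {v}. card (paths_to (arc_source a)))"
proof -
  let ?T = "\<lambda>a. (\<lambda>p. p @ [a]) ` paths_to (arc_source a)"
  have "card (\<Union>a\<in>arc_target -` {v}. ?T a) = (\<Sum>a\<in>arc_target -` {v}. card (?T a))"
    by (intro card_UN_disjoint) (auto simp: finite_arc_target_vimage finite_paths_to)
  moreover have "card (?T a) = card (paths_to (arc_source a))" for a
    by (intro card_image) (auto simp: inj_on_def)
  moreover have "card (paths_to v) = card (if v = (0, 0) then {[]::arc list} else {}) +
    card (\<Union>a\<in>arc_target -` {v}. ?T a)"
    unfolding paths_to_unfold[OF assms]
    by (intro card_Un_disjoint) (auto simp: finite_arc_target_vimage finite_paths_to)
  ultimately show ?thesis by simp
qed

text \<open>In the first class both arcs end at the rightmost point of one circle; in the other two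
  they come from the touching circles below and above.\<close>

lemma arc_target_vimage:
  "arc_target -` {(4 * m + 2 * j, 2 * j)} = {(m - 1, j, D), (m - 1, j, Ubar)}" (is ?E)
  "arc_target -` {(4 * m + 2 * j + 1, 2 * j + 1)} = {(m, j, U), (m - 1, j + 1, Fbar)}" (is ?A)
  "arc_target -` {(4 * m + 2 * j + 3, 2 * j + 1)} = {(m, j, F), (m, j + 1, Dbar)}" (is ?B)
proof -
  have "arc_target a = (4 * m + 2 * j, 2 * j) \<longleftrightarrow> a \<in> {(m - 1, j, D), (m - 1, j, Ubar)}"
    "arc_target a = (4 * m + 2 * j + 1, 2 * j + 1) \<longleftrightarrow> a \<in> {(m, j, U), (m - 1, j + 1, Fbar)}"
    "arc_target a = (4 * m + 2 * j + 3, 2 * j + 1) \<longleftrightarrow> a \<in> {(m, j, F), (m, j + 1, Dbar)}" for a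
    by (cases a rule: arc_source.cases; simp; presburger)+
  then show ?E ?A ?B by blast+
qed

section \<open>Completion to packing paths\<close>

lemma lattice_point_cases:
  assumes "quarter_plane_path p"
  obtains m j where "endpoint p = lattice_point (4 * m + 2 * j, 2 * j)"
  | m j where "endpoint p = lattice_point (4 * m + 2 * j + 1, 2 * j + 1)"
  | m j where "endpoint p = lattice_point (4 * m + 2 * j + 3, 2 * j + 1)"
proof (cases p rule: rev_cases)
  case Nil
  then show ?thesis using that(1)[of 0 0] by simp
next
  case (snoc q a)
  obtain i j where "endpoint p = lattice_point (4 * (i + 1) + 2 * j, 2 * j) \<or>
     endpoint p = lattice_point (4 * i + 2 * j + 1, 2 * j + 1) \<or>
     endpoint p = lattice_point (4 * i + 2 * j + 3, 2 * j + 1) \<or>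
     endpoint p = lattice_point (4 * (i + 1) + 2 * (j - 1) + 1, 2 * (j - 1) + 1) \<or>
     endpoint p = lattice_point (4 * i + 2 * (j - 1) + 3, 2 * (j - 1) + 1)"
    unfolding snoc endpoint_snoc by (cases a rule: arc_target.cases) auto
  then show ?thesis using that by blast
qed

text \<open>One can always descend by one unit: \<open>Dbar\<close> from even height,
  \<open>D\<close> from odd height, with \<open>F\<close> inserted first where \<open>D\<close> is
  not allowed.\<close>

lemma quarter_plane_path_extend:
  assumes "p \<in> paths_to v" "0 < snd v"
  obtains q w where "q \<in> paths_to w" "prefix p q" "snd w < snd v"
proof -
  have qp: "quarter_plane_path p" and v: "endpoint p = lattice_point v"
    using assms by (auto simp: paths_to_def)
  from qp show thesis
  proof (cases rule: lattice_point_cases)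
    case (1 m j)
    with v have "v = (4 * m + 2 * j, 2 * j)" by simp
    with assms have "p @ [(m, j, Dbar)] \<in> paths_to (4 * m + 2 * j + 1, 2 * j - 1)"
      by (simp add: snoc_in_paths_to_iff)
    then show ?thesis using that \<open>v = _\<close> by force
  next
    case (2 m j)
    with v have "v = (4 * m + 2 * j + 1, 2 * j + 1)" by simp
    with assms have "(p @ [(m, j, F)]) @ [(m, j, D)] \<in> paths_to (4 * m + 2 * j + 4, 2 * j)"
      unfolding snoc_in_paths_to_iff by simp
    then show ?thesis using that \<open>v = _\<close> by force
  next
    case (3 m j)
    with v have "v = (4 * m + 2 * j + 3, 2 * j + 1)" by simp
    with assms have "p @ [(m, j, D)] \<in> paths_to (4 * m + 2 * j + 4, 2 * j)"
      by (simp add: snoc_in_paths_to_iff)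
    then show ?thesis using that \<open>v = _\<close> by force
  qed
qed

lemma paths_to_imp_partial_packing_path: "p \<in> paths_to v \<Longrightarrow> partial_packing_path p"
proof (induction "nat (snd v)" arbitrary: p v rule: less_induct)
  case less
  show ?case
  proof (cases "0 < snd v")
    case True
    with less.prems obtain q w where qw: "q \<in> paths_to w" "prefix p q" "snd w < snd v"
      by (rule quarter_plane_path_extend)
    with True have "partial_packing_path q" by (intro less.hyps) auto
    with qw show ?thesis
      by (auto simp: partial_packing_path_def intro: prefix_order.trans)
  next
    case False
    then have "snd v = 0" using less.prems paths_to_eq_empty[of v] by fastforce
    then have "packing_path p"
      using less.prems by (simp add: packing_path_def paths_to_def lattice_point_def)
    then show ?thesis by (auto simp: partial_packing_path_def)
  qed
qed

lemma quarter_plane_path_appendD: "quarter_plane_path (p @ q) \<Longrightarrow> quarter_plane_path p"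
  by (auto simp: quarter_plane_path_def successively_append_iff hd_append simp del: arc_curve.simps)

lemma num_partial_eq_card: "num_partial n k = card (paths_to (n, int k))"
proof -
  have "partial_packing_path p \<and> Re (endpoint p) = of_int n \<and> Im (endpoint p) = of_nat k * sqrt 3
      \<longleftrightarrow> p \<in> paths_to (n, int k)" for p
  proof
    assume "p \<in> paths_to (n, int k)"
    then show "partial_packing_path p \<and> Re (endpoint p) = of_int n \<and> Im (endpoint p) = of_nat k * sqrt 3"
      using paths_to_imp_partial_packing_path[of p "(n, int k)"]
      by (simp add: paths_to_def lattice_point_def)
  next
    assume *: "partial_packing_path p \<and> Re (endpoint p) = of_int n \<and> Im (endpoint p) = of_nat k * sqrt 3"
    then have "quarter_plane_path p"
      by (auto simp: partial_packing_path_def packing_path_def prefix_def dest: quarter_plane_path_appendD)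
    with * show "p \<in> paths_to (n, int k)"
      by (simp add: paths_to_def lattice_point_def complex_eq_iff)
  qed
  then show ?thesis by (simp add: num_partial_def)
qed

section \<open>Linear recurrences\<close>

lemma card_paths_to_recs:
  assumes "0 \<le> j"
  shows "card (paths_to (4 * m + 2 * j, 2 * j)) = of_bool (m = 0 \<and> j = 0) +
           card (paths_to (4 * m + 2 * j - 1, 2 * j + 1)) + card (paths_to (4 * m + 2 * j - 1, 2 * j - 1))"
    and "card (paths_to (4 * m + 2 * j + 1, 2 * j + 1)) =
           card (paths_to (4 * m + 2 * j, 2 * j)) + card (paths_to (4 * m + 2 * j - 1, 2 * j + 1))"
    and "card (paths_to (4 * m + 2 * j + 3, 2 * j + 1)) =
           card (paths_to (4 * m + 2 * j + 1, 2 * j + 1)) + card (paths_to (4 * m + 2 * j + 2, 2 * j + 2))"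
proof -
  show "card (paths_to (4 * m + 2 * j, 2 * j)) = of_bool (m = 0 \<and> j = 0) +
           card (paths_to (4 * m + 2 * j - 1, 2 * j + 1)) + card (paths_to (4 * m + 2 * j - 1, 2 * j - 1))"
    using assms card_paths_to[of "(4 * m + 2 * j, 2 * j)"] unfolding arc_target_vimage
    by (auto simp: algebra_simps)
  show "card (paths_to (4 * m + 2 * j + 1, 2 * j + 1)) =
           card (paths_to (4 * m + 2 * j, 2 * j)) + card (paths_to (4 * m + 2 * j - 1, 2 * j + 1))"
    using assms card_paths_to[of "(4 * m + 2 * j + 1, 2 * j + 1)"] unfolding arc_target_vimage
    by (auto simp: algebra_simps)
  show "card (paths_to (4 * m + 2 * j + 3, 2 * j + 1)) =
           card (paths_to (4 * m + 2 * j + 1, 2 * j + 1)) + card (paths_to (4 * m + 2 * j + 2, 2 * j + 2))"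
    using assms card_paths_to[of "(4 * m + 2 * j + 3, 2 * j + 1)"] unfolding arc_target_vimage
    by (auto simp: algebra_simps)
qed

subsection \<open>Generating functions of the three classes of endpoints\<close>

text \<open>At even height \<open>H\<close> the width is congruent to \<open>H\<close> modulo 4 (class \<open>E\<close>). At odd height it is
  congruent to \<open>H\<close> after \<open>U\<close> or \<open>Fbar\<close> (class \<open>A\<close>) and to \<open>H + 2\<close> after \<open>F\<close> or \<open>Dbar\<close>
  (class \<open>B\<close>). The index \<open>n\<close> is shifted so that each recurrence involves only rows
  \<open>n\<close> and \<open>n - 1\<close>.\<close>

definition count_E :: "nat \<Rightarrow> nat \<Rightarrow> nat" where
  "count_E n k = card (paths_to (4 * int n - 2 * int k, 2 * int k))"

definition count_A :: "nat \<Rightarrow> nat \<Rightarrow> nat" where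
  "count_A n k = card (paths_to (4 * int n - 2 * int k + 1, 2 * int k + 1))"

definition count_B :: "nat \<Rightarrow> nat \<Rightarrow> nat" where
  "count_B n k = card (paths_to (4 * int n - 2 * int k - 1, 2 * int k + 1))"

text \<open>The \<open>count_A\<close> term is dropped where its endpoint has height
  \<open>-1\<close> (\<open>k = 0\<close>) or negative width (\<open>n = 0\<close>,
  \<open>k > 0\<close>), so the natural subtractions are exact.\<close>

lemma count_E_rec:
  "count_E n k = of_bool (n = 0 \<and> k = 0) + count_B n k +
     (if n = 0 \<or> k = 0 then 0 else count_A (n - 1) (k - 1))"
  using card_paths_to_recs(1)[of "int k" "int n - int k"]
  by (auto simp: count_E_def count_A_def count_B_def paths_to_eq_empty of_nat_diff algebra_simps)

lemma count_A_rec: "count_A n k = count_E n k + count_B n k"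
  using card_paths_to_recs(2)[of "int k" "int n - int k"]
  by (simp add: count_E_def count_A_def count_B_def algebra_simps)

lemma count_B_rec: "count_B n k = (if n = 0 then 0 else count_A (n - 1) k) + count_E n (Suc k)"
  using card_paths_to_recs(3)[of "int k" "int n - int k - 1"]
  by (auto simp: count_E_def count_A_def count_B_def paths_to_eq_empty of_nat_diff algebra_simps)

text \<open>\<open>f ^ k\<close> is divisible by \<open>fps_X ^ k\<close>. This matches the absence
  of paths of negative width.\<close>

lemma fps_mult_power_nth_eq_0:
  fixes f :: "'a::comm_ring_1 fps"
  assumes "fps_nth f 0 = 0" "n < k"
  shows "fps_nth (c * f ^ k) n = 0"
  unfolding fps_mult_nth
  using startsby_zero_power_prefix[OF assms(1), of k] assms(2) by (intro sum.neutral) auto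

text \<open>Induction on the width rather than on \<open>n\<close>: within a row the recurrences increase \<open>k\<close>, but
  every arc decreases the remaining width.\<close>

lemma count_eq_fps_nth_aux:
  fixes f h :: "real fps"
  assumes f: "f\<^sup>2 - (1 - 3 * fps_X) * f + fps_X = 0" "fps_nth f 0 = 0"
    and h: "h * (1 - 2 * fps_X - f) = 1"
  shows "4 * int n - 2 * int k < int w \<Longrightarrow>
           real (count_E n k) = fps_nth ((1 - fps_X) * h * f ^ k) n"
    and "4 * int n - 2 * int k + 1 < int w \<Longrightarrow>
           real (count_A n k) = fps_nth (h * (1 + f) * f ^ k) n"
    and "4 * int n - 2 * int k - 1 < int w \<Longrightarrow>
           real (count_B n k) = fps_nth (h * (f + fps_X) * f ^ k) n"
proof (induction w arbitrary: n k)
  case 0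
  {
    case 1
    then have "n < k" by linarith
    with 1 f(2) show ?case
      by (simp add: count_E_def paths_to_eq_empty fps_mult_power_nth_eq_0)
  next
    case 2
    then have "n < k" by linarith
    with 2 f(2) show ?case
      by (simp add: count_A_def paths_to_eq_empty fps_mult_power_nth_eq_0)
  next
    case 3
    \<comment> \<open>At \<open>n = k = 0\<close> the width is \<open>-1\<close>, and
      \<open>f + fps_X\<close> has constant term 0.\<close>
    then have "n < k \<or> n = 0 \<and> k = 0" by linarith
    with 3 f(2) show ?case
      by (auto simp: count_B_def paths_to_eq_empty fps_mult_power_nth_eq_0)
  }
next
  case (Suc w)
  have E: "real (count_E n k) = fps_nth ((1 - fps_X) * h * f ^ k) n"
    if "4 * int n - 2 * int k < int (Suc w)" for n k
  proof -
    have B: "real (count_B n k) = fps_nth (h * (f + fps_X) * f ^ k) n"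
      using that by (intro Suc.IH) auto
    show ?thesis
    proof (cases k)
      case 0
      \<comment> \<open>In column 0 the recurrence for \<open>count_E\<close> is the defining
        equation of \<open>h\<close>.\<close>
      have "(1 - fps_X) * h = 1 + h * (f + fps_X)" using h by algebra
      then show ?thesis using B 0 by (subst count_E_rec) simp
    next
      case (Suc l)
      \<comment> \<open>In later columns it is the quadratic for \<open>f\<close>, multiplied by
        \<open>h * f ^ l\<close>; \<open>q\<close> below stands for \<open>f ^ l\<close>.\<close>
      have "(1 - fps_X) * f = (f + fps_X) * f + fps_X * (1 + f)" using f(1) by algebra
      then have "(1 - fps_X) * h * (f * q) = h * (f + fps_X) * (f * q) + fps_X * (h * (1 + f) * q)"
        for q by algebra
      then have "(1 - fps_X) * h * f ^ k = h * (f + fps_X) * f ^ k + fps_X * (h * (1 + f) * f ^ l)"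
        by (simp add: Suc)
      moreover have "real (count_A (n - 1) l) = fps_nth (h * (1 + f) * f ^ l) (n - 1)" if "n \<noteq> 0"
        using that Suc \<open>4 * int n - 2 * int k < _\<close> by (intro Suc.IH) (auto simp: of_nat_diff)
      ultimately show ?thesis using B Suc by (subst count_E_rec) simp
    qed
  qed
  have B: "real (count_B n k) = fps_nth (h * (f + fps_X) * f ^ k) n"
    if "4 * int n - 2 * int k - 1 < int (Suc w)" for n k
  proof -
    \<comment> \<open>Unlike the one for \<open>count_E\<close>, the recurrences for
      \<open>count_B\<close> and \<open>count_A\<close> hold as polynomial identities in
      \<open>f\<close> and \<open>h\<close>.\<close>
    have "h * (f + fps_X) * f ^ k = fps_X * (h * (1 + f) * f ^ k) + (1 - fps_X) * h * f ^ Suc k"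
      unfolding power_Suc by algebra
    moreover have "real (count_A (n - 1) k) = fps_nth (h * (1 + f) * f ^ k) (n - 1)" if "n \<noteq> 0"
      using that \<open>4 * int n - 2 * int k - 1 < _\<close> by (intro Suc.IH) (auto simp: of_nat_diff)
    moreover have "real (count_E n (Suc k)) = fps_nth ((1 - fps_X) * h * f ^ Suc k) n"
      using that by (intro E) auto
    ultimately show ?thesis by (subst count_B_rec) simp
  qed
  {
    case 1
    then show ?case by (rule E)
  next
    case 2
    have "h * (1 + f) * f ^ k = (1 - fps_X) * h * f ^ k + h * (f + fps_X) * f ^ k" by algebra
    then show ?case using 2 E[of n k] B[of n k] by (simp add: count_A_rec)
  next
    case 3
    then show ?case by (rule B)
  }
qed

lemma count_eq_fps_nth:
  fixes f h :: "real fps"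
  assumes "f\<^sup>2 - (1 - 3 * fps_X) * f + fps_X = 0" "fps_nth f 0 = 0"
    and "h * (1 - 2 * fps_X - f) = 1"
  shows "real (count_E n k) = fps_nth ((1 - fps_X) * h * f ^ k) n"
    and "real (count_A n k) = fps_nth (h * (1 + f) * f ^ k) n"
    and "real (count_B n k) = fps_nth (h * (f + fps_X) * f ^ k) n"
  \<comment> \<open>The largest of the three widths is \<open>4 * n - 2 * k + 1\<close>, which is
    below \<open>4 * n + 2\<close>.\<close>
  by (rule count_eq_fps_nth_aux[OF assms, where w = "4 * n + 2"]; simp)+

section \<open>The even and odd matrices\<close>

lemma even_matrix_eq: "even_matrix n k = count_E n k"
  by (simp add: even_matrix_def num_partial_eq_card count_E_def)

text \<open>Width minus height is \<open>2 * (n - k)\<close>, divisible by 4 exactly when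
  \<open>n + k\<close> is even; this separates class \<open>A\<close> from class
  \<open>B\<close>.\<close>

lemma odd_matrix_eq:
  "odd_matrix n k =
     (if even (n + k) then count_A ((n + k) div 2) k else count_B ((n + k + 1) div 2) k)"
proof -
  have *: "odd_matrix n k = card (paths_to (2 * int n + 1, 2 * int k + 1))"
    by (simp add: odd_matrix_def num_partial_eq_card add.commute[of 1])
  show ?thesis
  proof (cases "even (n + k)")
    case True
    then obtain m where "n + k = 2 * m" by blast
    then have "(n + k) div 2 = m" "2 * int n + 1 = 4 * int m - 2 * int k + 1" by auto
    with True show ?thesis by (simp only: * count_A_def if_True)
  next
    case False
    then obtain m where "n + k + 1 = 2 * m" by (metis even_Suc evenE Suc_eq_plus1)
    then have "(n + k + 1) div 2 = m" "2 * int n + 1 = 4 * int m - 2 * int k - 1" by auto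
    with False show ?thesis by (simp only: * count_B_def if_False)
  qed
qed

theorem theorem3:
  fixes x :: "real fps"
  defines "x \<equiv> fps_X"
  shows "is_riordan_array (\<lambda>n k. real (even_matrix n k))
           ((1 - x - fps_sqrt (1 - 10 * x + 9 * x ^ 2)) / (4 * x))
           ((1 - 3 * x - fps_sqrt (1 - 10 * x + 9 * x ^ 2)) / 2)
       \<and> is_riordan_array (\<lambda>n k. real (odd_matrix n k))
           ((1 + 2 * x - 5 * x ^ 2 - 6 * x ^ 3
               - (1 + 2 * x) * fps_sqrt (1 - 10 * x ^ 2 + 9 * x ^ 4)) / (4 * x ^ 3))
           ((1 - 3 * x ^ 2 - fps_sqrt (1 - 10 * x ^ 2 + 9 * x ^ 4)) / (2 * x))"
proof -
  define P where "P = 1 - 10 * x + 9 * x ^ 2"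
  define s where "s = fps_sqrt P"
  define f where "f = fps_const (1 / 2) * (1 - 3 * x - s)"
  define h where "h = inverse (1 - 2 * x - f)"
  have x0: "fps_nth x 0 = 0" by (simp add: x_def)
  have P0: "fps_nth P 0 = 1" by (simp add: P_def x_def)
  have s_sq: "s ^ 2 = P" and s0: "fps_nth s 0 = 1"
    using power_radical[of P root 1] P0 by (simp_all add: s_def numeral_2_eq_2)
  have s_eq: "s = 1 - 3 * x - 2 * f"
    by (simp add: f_def mult.assoc[symmetric] numeral_fps_const fps_const_mult)
  have f_quad: "f\<^sup>2 - (1 - 3 * x) * f + x = 0"
  proof -
    have "4 * (f\<^sup>2 - (1 - 3 * x) * f + x) = 0"
      using s_sq unfolding s_eq P_def by algebra
    then show ?thesis by (simp only: mult_eq_0_iff) simp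
  qed
  have f0: "fps_nth f 0 = 0" using s0 by (simp add: f_def x0)
  have "fps_nth (f\<^sup>2 - (1 - 3 * x) * f + x) 1 = 0" using f_quad by simp
  then have f1: "fps_nth f 1 = 1"
    using f0 by (simp add: x_def fps_mult_nth power2_eq_square)
  have h_inv: "h * (1 - 2 * x - f) = 1"
    unfolding h_def by (rule inverse_mult_eq_1) (simp add: x0 f0)
  have h0: "fps_nth h 0 = 1" using f0 by (simp add: h_def x0)
  note count = count_eq_fps_nth[OF f_quad[unfolded x_def] f0 h_inv[unfolded x_def], folded x_def]

  \<comment> \<open>The left side is \<open>2 * (f + x)\<close>, and the quadratic gives
    \<open>(f + x) * (1 - 2 * x - f) = 2 * x * (1 - x)\<close>.\<close>
  have "1 - x - s = 4 * x * ((1 - x) * h)"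
    using f_quad h_inv unfolding s_eq by algebra
  then have g_even: "(1 - x - s) / (4 * x) = (1 - x) * h"
    by (simp add: x_def)
  have f_even: "(1 - 3 * x - s) / 2 = f"
    by (simp add: s_eq)
  have even_part: "is_riordan_array (\<lambda>n k. real (even_matrix n k)) ((1 - x - s) / (4 * x)) ((1 - 3 * x - s) / 2)"
    unfolding g_even f_even is_riordan_array_def
    using f0 f1 h0 by (simp add: x0 even_matrix_eq count)

  text \<open>The odd columns interleave the classes \<open>A\<close> and \<open>B\<close>, whose series are taken at \<open>x ^ 2\<close>.\<close>
  define y where "y = x ^ 2"
  have y0: "fps_nth y 0 = 0" by (simp add: y_def x0)
  note compose = fps_compose_add_distrib fps_compose_sub_distrib
    fps_compose_mult_distrib[OF y0] fps_compose_power[OF y0, symmetric]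
  have x_y: "x oo y = y" unfolding x_def by (rule fps_X_fps_compose_startby0[OF y0])
  have num_y: "numeral n oo y = numeral n" for n by (simp add: numeral_fps_const)
  define f' h' where "f' = f oo y" and "h' = h oo y"
  have sqrt_y: "fps_sqrt (1 - 10 * x ^ 2 + 9 * x ^ 4) = 1 - 3 * y - 2 * f'"
  proof -
    have "P oo y = 1 - 10 * y + 9 * y ^ 2"
      by (simp add: P_def compose x_y num_y)
    then have "P oo y = 1 - 10 * x ^ 2 + 9 * x ^ 4"
      by (simp add: y_def flip: power_mult)
    moreover have "s oo y = fps_sqrt (P oo y)"
      using fps_compose_radical[OF y0, of root 1 P] P0 by (simp add: s_def numeral_2_eq_2)
    moreover have "s oo y = 1 - 3 * y - 2 * f'"
      by (simp add: s_eq f'_def compose x_y num_y)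
    ultimately show ?thesis by simp
  qed
  have f'_quad: "f'\<^sup>2 - (1 - 3 * y) * f' + y = 0"
    using arg_cong[OF f_quad, of "\<lambda>r. r oo y"] by (simp add: compose x_y num_y f'_def)
  have h'_inv: "h' * (1 - 2 * y - f') = 1"
    using arg_cong[OF h_inv, of "\<lambda>r. r oo y"] by (simp add: compose x_y num_y f'_def h'_def)
  \<comment> \<open>\<open>f\<close> and \<open>h * (f + x)\<close> have constant term 0, so the
    shifts divide them by \<open>x\<close> exactly.\<close>
  define u where "u = fps_shift 1 f oo y"
  define v where "v = fps_shift 1 (h * (f + x)) oo y"
  have "f = x * fps_shift 1 f"
    using f0 by (simp add: x_def fps_eq_iff)
  then have f'_u: "f' = y * u"
    unfolding f'_def u_def using x_y by (metis fps_compose_mult_distrib[OF y0])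
  have "h * (f + x) = x * fps_shift 1 (h * (f + x))"
    using f0 by (simp add: x_def fps_eq_iff)
  then have "h * (f + x) oo y = y * v"
    unfolding v_def using x_y by (metis fps_compose_mult_distrib[OF y0])
  then have v: "h' * (f' + y) = y * v"
    by (simp add: compose x_y h'_def f'_def)
  \<comment> \<open>Column 0: class \<open>A\<close> fills the even rows, and class
    \<open>B\<close>, moved up one row, the odd rows, where
    \<open>h' * (f' + y) / x = x * v\<close>.\<close>
  define g where "g = h' * (1 + f') + x * v"
  \<comment> \<open>Separating odd and even powers of \<open>x\<close> leaves
    \<open>f' = y * h' * (1 + f')\<close> and \<open>f' - y = 2 * y * h' * (f' + y)\<close>; both
    follow from the quadratic on multiplying by \<open>1 - 2 * y - f'\<close>.\<close>
  have "1 + 2 * x - 5 * x ^ 2 - 6 * x ^ 3 - (1 + 2 * x) * (1 - 3 * y - 2 * f') = 4 * x ^ 3 * g"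
    using f'_quad h'_inv v unfolding g_def y_def by algebra
  then have g_odd: "(1 + 2 * x - 5 * x ^ 2 - 6 * x ^ 3 - (1 + 2 * x) * (1 - 3 * y - 2 * f')) / (4 * x ^ 3) = g"
    by (simp add: x_def)
  have "1 - 3 * x ^ 2 - (1 - 3 * y - 2 * f') = 2 * x * (x * u)"
    unfolding f'_u y_def by algebra
  then have f_odd: "(1 - 3 * x ^ 2 - (1 - 3 * y - 2 * f')) / (2 * x) = x * u"
    by (simp add: x_def)
  have "real (odd_matrix n k) = fps_nth (g * (x * u) ^ k) n" for n k
  proof -
    \<comment> \<open>Index \<open>m\<close> of column \<open>k\<close> sits in row
      \<open>2 * m - k\<close> for class \<open>A\<close> and \<open>2 * m - k - 1\<close> for class
      \<open>B\<close>; the factor \<open>x ^ (k + 1)\<close> clears these negative shifts.\<close>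
    have "x ^ (k + 1) * (g * (x * u) ^ k) = x * (h' * (1 + f') * f' ^ k) + h' * (f' + y) * f' ^ k"
    proof -
      have "x ^ (k + 1) * (g * (x * u) ^ k) = x * g * f' ^ k"
        by (simp add: f'_u y_def power_mult_distrib power2_eq_square mult_ac)
      also have "x * g = x * (h' * (1 + f')) + h' * (f' + y)"
        using v unfolding g_def y_def by algebra
      finally show ?thesis by (simp add: algebra_simps)
    qed
    also have "\<dots> = x * (h * (1 + f) * f ^ k oo y) + (h * (f + x) * f ^ k oo y)"
      by (simp add: compose x_y f'_def h'_def)
    finally have "fps_nth (x ^ (k + 1) * (g * (x * u) ^ k)) (n + k + 1) =
      fps_nth (x * (h * (1 + f) * f ^ k oo y) + (h * (f + x) * f ^ k oo y)) (n + k + 1)"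
      by simp
    \<comment> \<open>Series in \<open>x ^ 2\<close> have only even powers, so the parity of
      \<open>n + k + 1\<close> selects one of the two summands.\<close>
    then show ?thesis
      by (simp add: x_def y_def fps_X_power_mult_nth fps_nth_compose_X_power odd_matrix_eq
            count[unfolded x_def] del: power_Suc)
  qed
  moreover have "fps_nth g 0 = 1" "fps_nth u 0 = 1"
    using f0 f1 h0 by (simp_all add: g_def x0 h'_def f'_def u_def)
  ultimately have odd_part: "is_riordan_array (\<lambda>n k. real (odd_matrix n k)) g (x * u)"
    by (simp add: is_riordan_array_def x_def)
  show ?thesis
    using even_part odd_part unfolding sqrt_y g_odd f_odd s_def P_def by blast
qed

end
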